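(* Oda's Conjecture and Bøgvad's Conjecture are true for nestohedra. That is, let $n$ be a positive integer, let $\mathcal{B}$ be a building set on $[n]=\{1,\dots,n\}$, let $\mathcal{P}_{\mathcal{B}} = \sum_{S\in\mathcal{B}} \Delta_S \subset \mathbb{R}^n$ be the associated nestohedron, and let $K$ be a field. Then $\mathcal{P}_{\mathcal{B}}$ has the integer decomposition property, and the toric ideal of $\mathcal{P}_{\mathcal{B}}$ (over $K$) is generated by quadratic binomials.
   Context: A building set on $[n]$ is a collection $\mathcal{B}$ of nonempty subsets of $[n]$ such that (i) if $I,J\in\mathcal{B}$ and $I\cap J\neq\emptyset$, then $I\cup J\in\mathcal{B}$; and (ii) $\{i\}\in\mathcal{B}$ for each $i=1,\dots,n$. For nonempty $S\subset[n]$, $\Delta_S$ is the convex hull of $\{\mathbf{e}_i : i\in S\}\subset\mathbb{R}^n$, where $\mathbf{e}_i$ is the $i$-th unit vector. The nestohedron $\mathcal{P}_{\mathcal{B}}$ is the Minkowski sum of the $\Delta_S$, $S\in\mathcal{B}$. (Nestohedra are smooth polytopes; Oda's Conjecture says every smooth polytope has the integer decomposition property, and Bøgvad's Conjecture says the toric ideal of every smooth polytope is generated by quadratic binomials.) A lattice polytope $P \subset \mathbb{R}^d$ is a convex polytope all of whose vertices lie in $\mathbb{Z}^d$. It has the integer decomposition property if for every positive integer $k$ and every $\alpha \in kP \cap \mathbb{Z}^d$ there exist $\alpha_1,\dots,\alpha_k \in P\cap\mathbb{Z}^d$ with $\alpha = \alpha_1+\cdots+\alpha_k$. The toric ideal of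 a lattice polytope $P\subset\mathbb{R}^d$ over a field $K$: let $\mathcal{A}_P = \{(\alpha,1)\in\mathbb{Z}^{d+1} : \alpha \in P\cap\mathbb{Z}^d\} = \{\mathbf{a}_1,\dots,\mathbf{a}_m\}$ (distinct points). The toric ideal is the kernel of the $K$-algebra homomorphism $\pi: K[x_1,\dots,x_m] \to K[t_1^{\pm1},\dots,t_{d+1}^{\pm1}]$, $\pi(x_i) = \mathbf{t}^{\mathbf{a}_i}$, where $\mathbf{t}^{\mathbf{a}} = t_1^{a_1}\cdots t_{d+1}^{a_{d+1}}$. A quadratic binomial is a binomial homogeneous of degree $2$; the zero ideal is regarded as generated by the empty set of quadratic binomials. *)

theory Defs
  imports "HOL-Analysis.Analysis" "HOL-Library.Poly_Mapping"
begin

section \<open>Building sets and nestohedra\<close>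

text \<open>
  The ground set $[n]$ is a finite type \<open>'n\<close> with $n$ elements, and $R^n$ is \<open>real ^ 'n\<close>.
\<close>

definition building_set :: "'n::finite set set \<Rightarrow> bool" where
  "building_set B \<longleftrightarrow>
     {} \<notin> B \<and>
     (\<forall>I\<in>B. \<forall>J\<in>B. I \<inter> J \<noteq> {} \<longrightarrow> I \<union> J \<in> B) \<and>
     (\<forall>i. {i} \<in> B)"

definition simplex_of :: "'n::finite set \<Rightarrow> (real ^ 'n) set" where
  "simplex_of S = convex hull ((\<lambda>i. axis i 1) ` S)"

text \<open>The sum below is the Minkowski sum, i.e. addition of sets from \<open>Set_Algebras\<close>.\<close>

definition nestohedron :: "'n::finite set set \<Rightarrow> (real ^ 'n) set" where
  "nestohedron B = (\<Sum>S\<in>B. simplex_of S)"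


section \<open>Lattice polytopes and the integer decomposition property\<close>

definition lattice_polytope :: "(real ^ 'n::finite) set \<Rightarrow> bool" where
  "lattice_polytope P \<longleftrightarrow> polytope P \<and> (\<forall>v. v extreme_point_of P \<longrightarrow> (\<forall>i. v $ i \<in> \<int>))"

definition real_vec :: "int ^ 'n \<Rightarrow> real ^ 'n" where
  "real_vec \<alpha> = (\<chi> i. real_of_int (\<alpha> $ i))"

definition lattice_points :: "(real ^ 'n) set \<Rightarrow> (int ^ 'n) set" where
  "lattice_points P = {\<alpha>. real_vec \<alpha> \<in> P}"

definition integer_decomposition_property :: "(real ^ 'n::finite) set \<Rightarrow> bool" where
  "integer_decomposition_property P \<longleftrightarrow>
     lattice_polytope P \<and>
     (\<forall>k::nat. k \<ge> 1 \<longrightarrow>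
       (\<forall>\<alpha> \<in> lattice_points ((\<lambda>x. real k *\<^sub>R x) ` P).
          \<exists>\<beta> :: nat \<Rightarrow> int ^ 'n.
            (\<forall>j\<in>{1..k}. \<beta> j \<in> lattice_points P) \<and> \<alpha> = (\<Sum>j=1..k. \<beta> j)))"


section \<open>Toric ideals\<close>

text \<open>
  Polynomials over \<open>'k\<close> in indeterminates $x_a$ with \<open>a :: 'v\<close> are finitely supported maps from
  exponent vectors to coefficients; multiplication is convolution. In the same way
  \<open>'e \<Rightarrow>\<^sub>0 'k\<close> is the group algebra of an additive group \<open>'e\<close>, which for $Z^{d+1}$ is the ring of
  Laurent polynomials in $d+1$ variables.
\<close>

type_synonym ('v, 'k) polynomial = "('v \<Rightarrow>\<^sub>0 nat) \<Rightarrow>\<^sub>0 'k"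

text \<open>$Z^{d+1}$, split as $Z^d$ and the last coordinate.\<close>

type_synonym 'n exponent = "(int ^ 'n) \<times> int"

text \<open>The ring $K[x_a : a \in A]$, as a subring of the polynomials in all indeterminates.\<close>

definition polynomials_in :: "'v set \<Rightarrow> ('v, 'k::field) polynomial set" where
  "polynomials_in A = {f. \<forall>u \<in> Poly_Mapping.keys f. Poly_Mapping.keys u \<subseteq> A}"

definition ideal_generated_in :: "'r::comm_ring_1 set \<Rightarrow> 'r set \<Rightarrow> 'r set" where
  "ideal_generated_in R G =
     {(\<Sum>g\<in>F. c g * g) | F c. finite F \<and> F \<subseteq> G \<and> (\<forall>g\<in>F. c g \<in> R)}"

text \<open>
  The points $a_1, \dots, a_m$ themselves index the indeterminates of the polynomial ring, so no
  enumeration of them is chosen.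
\<close>

definition toric_configuration :: "(real ^ 'n::finite) set \<Rightarrow> 'n exponent set" where
  "toric_configuration P = {(\<alpha>, 1) | \<alpha>. \<alpha> \<in> lattice_points P}"

text \<open>
  Substitution of $t^a$ for $x_a$. The coefficient $c$ and the Laurent monomial $t^a$ are
  \<open>single 0 c\<close> and \<open>single a 1\<close>.
\<close>

definition toric_map :: "('e::ab_group_add, 'k::field) polynomial \<Rightarrow> 'e \<Rightarrow>\<^sub>0 'k" where
  "toric_map f =
     (\<Sum>u \<in> Poly_Mapping.keys f.
        Poly_Mapping.single 0 (Poly_Mapping.lookup f u) *
        (\<Prod>a \<in> Poly_Mapping.keys u. Poly_Mapping.single a 1 ^ Poly_Mapping.lookup u a))"

definition toric_ideal :: "(real ^ 'n::finite) set \<Rightarrow> ('n exponent, 'k::field) polynomial set" where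
  "toric_ideal P = {f \<in> polynomials_in (toric_configuration P). toric_map f = 0}"

definition monomial_degree :: "('v \<Rightarrow>\<^sub>0 nat) \<Rightarrow> nat" where
  "monomial_degree u = (\<Sum>a \<in> Poly_Mapping.keys u. Poly_Mapping.lookup u a)"

text \<open>A binomial is a difference of two distinct monomials.\<close>

definition quadratic_binomial :: "('v, 'k::field) polynomial \<Rightarrow> bool" where
  "quadratic_binomial g \<longleftrightarrow>
     (\<exists>u v. u \<noteq> v \<and> monomial_degree u = 2 \<and> monomial_degree v = 2 \<and>
            g = Poly_Mapping.single u 1 - Poly_Mapping.single v 1)"

definition toric_ideal_quadratically_generated ::
    "'k::field itself \<Rightarrow> (real ^ 'n::finite) set \<Rightarrow> bool" where
  "toric_ideal_quadratically_generated K P \<longleftrightarrow>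
     (\<exists>G :: ('n exponent, 'k) polynomial set.
        G \<subseteq> polynomials_in (toric_configuration P) \<and>
        (\<forall>g\<in>G. quadratic_binomial g) \<and>
        toric_ideal P = ideal_generated_in (polynomials_in (toric_configuration P)) G)"

end

theory Submission
  imports Defs
begin

text \<open>
  A point of $k P \cap Z^n$ is a sum of \<open>k\<close> points, each
  given by choosing one element from every \<open>S \<in> B\<close>: this is a system of representatives with
  prescribed multiplicities for the family containing every \<open>S\<close> exactly \<open>k\<close> times, and Rado's
  argument provides one. A monomial of degree \<open>k\<close> is thus a table with \<open>k\<close> rows
  and one column per \<open>S\<close>, and exchanging two entries of a column is a quadratic relation. Hence
  only the multiplicities of the entries in each column matter. If two tables of the same weight
  have different multiplicities, the differences form cycles; a cycle involves each of its columns
  once, so its entries can be moved into a single row, and shifting them along the cycle does not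
  change the point that this row represents.
\<close>

section \<open>Systems of representatives\<close>

text \<open>Induction on the total size of the sets. If all are singletons, the bounds at singletons
  \<open>R\<close> together with \<open>total\<close> force equality. Otherwise an element can be
  deleted from some \<open>A r\<close> without violating the bounds, because the number of sets
  inside \<open>R\<close> is supermodular in \<open>R\<close> while \<open>sum w\<close> is
  modular.\<close>

lemma system_of_representatives_exact:
  fixes A :: "'r \<Rightarrow> 'n::finite set" and w :: "'n \<Rightarrow> int"
  assumes "finite X"
    and "\<And>R. int (card {r\<in>X. A r \<subseteq> R}) \<le> sum w R"
    and total: "sum w UNIV = int (card X)"
  shows "\<exists>f. (\<forall>r\<in>X. f r \<in> A r) \<and> (\<forall>j. int (card {r\<in>X. f r = j}) = w j)"
  using assms(2)
proof (induction "\<Sum>r\<in>X. card (A r)" arbitrary: A rule: less_induct)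
  case less
  note le = less.prems
  have nonempty: "A r \<noteq> {}" if "r \<in> X" for r
  proof
    assume "A r = {}"
    then have "r \<in> {r\<in>X. A r \<subseteq> {}}" using that by simp
    then have "card {r\<in>X. A r \<subseteq> {}} > 0"
      using \<open>finite X\<close> by (subst card_gt_0_iff) auto
    then show False using le[of "{}"] by simp
  qed
  show ?case
  proof (cases "\<forall>r\<in>X. \<exists>j. A r = {j}")
    case True
    then obtain f where f: "\<And>r. r \<in> X \<Longrightarrow> A r = {f r}" by metis
    have "{r\<in>X. A r \<subseteq> {j}} = {r\<in>X. f r = j}" for j
      using f by auto
    then have le': "int (card {r\<in>X. f r = j}) \<le> w j" for j
      using le[of "{j}"] by simp
    have "card X = (\<Sum>j\<in>UNIV. card {r\<in>X. f r = j})"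
      using sum.group[of X UNIV f "\<lambda>_. 1::nat"] \<open>finite X\<close> by simp
    then have "(\<Sum>j\<in>UNIV. w j - int (card {r\<in>X. f r = j})) = 0"
      using total by (simp add: sum_subtractf)
    then have "\<forall>j\<in>UNIV. w j - int (card {r\<in>X. f r = j}) = 0"
      by (subst (asm) sum_nonneg_eq_0_iff) (use le' in auto)
    then have "(\<forall>r\<in>X. f r \<in> A r) \<and> (\<forall>j. int (card {r\<in>X. f r = j}) = w j)"
      using f by auto
    then show ?thesis by blast
  next
    case False
    then obtain r where r: "r \<in> X" "\<And>j. A r \<noteq> {j}" by blast
    then obtain x y where xy: "x \<in> A r" "y \<in> A r" "x \<noteq> y"
      using nonempty[OF r(1)] by blast
    define c where "c R = int (card {r\<in>X. A r \<subseteq> R})" for R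
    \<comment> \<open>If deleting \<open>z\<close> yields no solution, some \<open>R\<close>
      violates its bound after the deletion. Only \<open>r\<close> can be newly counted, so the
      bound at \<open>R\<close> was an equality before.\<close>
    have tight: "\<exists>R. A r - {z} \<subseteq> R \<and> z \<notin> R \<and> c R = sum w R"
      if z: "z \<in> A r"
        and no: "\<not> (\<exists>f. (\<forall>r\<in>X. f r \<in> A r) \<and> (\<forall>j. int (card {r\<in>X. f r = j}) = w j))" for z
    proof -
      define A' where "A' = A(r := A r - {z})"
      have sub: "A' s \<subseteq> A s" for s by (auto simp: A'_def)
      have "card (A' s) \<le> card (A s)" for s by (simp add: sub card_mono)
      moreover have "card (A' r) < card (A r)"
        using z by (intro psubset_card_mono) (auto simp: A'_def)
      ultimately have "(\<Sum>s\<in>X. card (A' s)) < (\<Sum>s\<in>X. card (A s))"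
        using r \<open>finite X\<close> by (intro sum_strict_mono_ex1) auto
      from less.hyps[OF this] no sub obtain R where R: "sum w R < int (card {s\<in>X. A' s \<subseteq> R})"
        by (meson not_le subsetD)
      have "card {s\<in>X. A' s \<subseteq> R} \<le> card (insert r {s\<in>X. A s \<subseteq> R})"
        by (rule card_mono) (use \<open>finite X\<close> in \<open>auto simp: A'_def split: if_splits\<close>)
      also have "\<dots> \<le> Suc (card {s\<in>X. A s \<subseteq> R})"
        using \<open>finite X\<close> by (simp add: card_insert_if)
      finally have eq: "c R = sum w R" using R le[of R] unfolding c_def by linarith
      have "\<not> {s\<in>X. A' s \<subseteq> R} \<subseteq> {s\<in>X. A s \<subseteq> R}"
        using R le[of R] card_mono[of "{s\<in>X. A s \<subseteq> R}" "{s\<in>X. A' s \<subseteq> R}"] \<open>finite X\<close> by auto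
      then have "A' r \<subseteq> R" "\<not> A r \<subseteq> R"
        by (auto simp: A'_def split: if_splits)
      then show ?thesis using eq by (intro exI[of _ R]) (auto simp: A'_def)
    qed
    show ?thesis
    proof (rule ccontr)
      assume no: "\<not> ?thesis"
      obtain R where R: "A r - {x} \<subseteq> R" "x \<notin> R" "c R = sum w R"
        using tight[OF xy(1) no] by blast
      obtain T where T: "A r - {y} \<subseteq> T" "y \<notin> T" "c T = sum w T"
        using tight[OF xy(2) no] by blast
      have fin: "finite {s\<in>X. P s}" for P using \<open>finite X\<close> by simp
      \<comment> \<open>Uncrossing the tight sets \<open>R\<close> and \<open>T\<close>: the index
        \<open>r\<close> is counted for \<open>R \<union> T\<close> but neither for \<open>R\<close>
        nor for \<open>T\<close>, so supermodularity is strict and contradicts the bounds at the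
        union and the intersection.\<close>
      have "card {s\<in>X. A s \<subseteq> R} + card {s\<in>X. A s \<subseteq> T} =
            card ({s\<in>X. A s \<subseteq> R} \<union> {s\<in>X. A s \<subseteq> T}) + card ({s\<in>X. A s \<subseteq> R} \<inter> {s\<in>X. A s \<subseteq> T})"
        by (rule card_Un_Int) (use \<open>finite X\<close> in auto)
      also have "{s\<in>X. A s \<subseteq> R} \<inter> {s\<in>X. A s \<subseteq> T} = {s\<in>X. A s \<subseteq> R \<inter> T}" by auto
      also have "card ({s\<in>X. A s \<subseteq> R} \<union> {s\<in>X. A s \<subseteq> T}) < card {s\<in>X. A s \<subseteq> R \<union> T}"
      proof (rule psubset_card_mono[OF fin])
        have "r \<in> {s\<in>X. A s \<subseteq> R \<union> T}" using R T r xy by auto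
        moreover have "r \<notin> {s\<in>X. A s \<subseteq> R} \<union> {s\<in>X. A s \<subseteq> T}" using R T xy by auto
        ultimately show "{s\<in>X. A s \<subseteq> R} \<union> {s\<in>X. A s \<subseteq> T} \<subset> {s\<in>X. A s \<subseteq> R \<union> T}" by blast
      qed
      finally have "c R + c T < c (R \<union> T) + c (R \<inter> T)" by (simp add: c_def)
      also have "\<dots> \<le> sum w (R \<union> T) + sum w (R \<inter> T)"
        unfolding c_def by (intro add_mono le)
      also have "\<dots> = sum w R + sum w T" by (rule sum.union_inter) auto
      finally show False using R T by simp
    qed
  qed
qed

section \<open>Lattice points of dilated nestohedra\<close>

text \<open>Integer coordinates make these lattice points by type. Distinct choices may give the
  same point, which the shift along a cycle exploits.\<close>

definition choice_point :: "'n::finite set set \<Rightarrow> ('n set \<Rightarrow> 'n) \<Rightarrow> int ^ 'n" where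
  "choice_point B f = (\<Sum>S\<in>B. axis (f S) 1)"

lemma real_vec_sum: "real_vec (\<Sum>i\<in>I. v i) = (\<Sum>i\<in>I. real_vec (v i))"
  by (simp add: real_vec_def vec_eq_iff)

lemma real_vec_axis: "real_vec (axis i 1) = axis i 1"
  by (simp add: real_vec_def vec_eq_iff axis_def)

lemma nestohedron_eq_hull:
  "nestohedron B = convex hull (\<Sum>S\<in>B. (\<lambda>i. axis i 1) ` S)"
  unfolding nestohedron_def simplex_of_def by (simp add: convex_hull_set_sum)

lemma vertex_sum_eq:
  fixes B :: "'n::finite set set"
  shows "(\<Sum>S\<in>B. (\<lambda>i. axis i 1 :: real ^ 'n) ` S) =
    {real_vec (choice_point B f) | f. \<forall>S\<in>B. f S \<in> S}"
proof -
  have "(\<exists>s. v = sum s B \<and> (\<forall>S\<in>B. s S \<in> (\<lambda>i. axis i 1 :: real ^ 'n) ` S)) \<longleftrightarrow>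
        (\<exists>f. v = (\<Sum>S\<in>B. axis (f S) 1) \<and> (\<forall>S\<in>B. f S \<in> S))" (is "?L \<longleftrightarrow> ?R") for v
  proof
    assume ?L
    then obtain s where s: "v = sum s B" "\<forall>S\<in>B. \<exists>i\<in>S. s S = axis i 1"
      by (auto simp: image_iff)
    from bchoice[OF s(2)[unfolded Bex_def]] obtain f
      where f: "\<forall>S\<in>B. f S \<in> S \<and> s S = axis (f S) 1" by blast
    then show ?R using s by (intro exI[of _ f]) auto
  qed auto
  then show ?thesis
    by (simp add: set_sum_alt choice_point_def real_vec_sum real_vec_axis)
qed

lemma choice_point_in_nestohedron:
  assumes "\<forall>S\<in>B. f S \<in> S"
  shows "choice_point B f \<in> lattice_points (nestohedron B)"
  unfolding lattice_points_def nestohedron_eq_hull vertex_sum_eq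
  using assms by (auto intro!: hull_inc)

text \<open>The polytope is the hull of finitely many integral points, and every extreme point of a
  hull is one of the generating points.\<close>

lemma lattice_polytope_nestohedron:
  fixes B :: "'n::finite set set"
  shows "lattice_polytope (nestohedron B)"
proof -
  have "finite (\<Sum>S\<in>B. (\<lambda>i. axis i 1 :: real ^ 'n) ` S)"
    by (intro finite_set_sum) auto
  then have "polytope (nestohedron B)"
    unfolding polytope_def nestohedron_eq_hull by blast
  moreover have "v $ i \<in> \<int>" if "v extreme_point_of nestohedron B" for v i
  proof -
    have "v \<in> (\<Sum>S\<in>B. (\<lambda>i. axis i 1) ` S)"
      using that unfolding nestohedron_eq_hull by (rule extreme_point_of_convex_hull)
    then show ?thesis by (auto simp: vertex_sum_eq real_vec_def)
  qed
  ultimately show ?thesis by (simp add: lattice_polytope_def)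
qed

section \<open>Decomposition of lattice points in dilations\<close>

text \<open>Both regions are convex and contain the generating unit vectors. Summed over
  \<open>B\<close>, the bounds say that the coordinates in \<open>R\<close> of a point of the
  nestohedron add up to at least the number of members of \<open>B\<close> inside
  \<open>R\<close>.\<close>

lemma simplex_of_bounds:
  assumes "p \<in> simplex_of S"
  shows "0 \<le> (\<Sum>j\<in>R. p $ j)" "S \<subseteq> R \<Longrightarrow> (\<Sum>j\<in>R. p $ j) = 1"
proof -
  have "simplex_of S \<subseteq> {p. \<forall>j. 0 \<le> p $ j}"
    unfolding simplex_of_def
    by (rule hull_minimal) (auto simp: axis_def convex_def)
  then show "0 \<le> (\<Sum>j\<in>R. p $ j)" using assms by (auto intro: sum_nonneg)
  assume "S \<subseteq> R"
  have "convex {p :: real ^ 'a. (\<Sum>j\<in>R. p $ j) = 1}"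
    by (auto simp: convex_def sum.distrib simp flip: sum_distrib_left)
  then have "simplex_of S \<subseteq> {p. (\<Sum>j\<in>R. p $ j) = 1}"
    unfolding simplex_of_def using \<open>S \<subseteq> R\<close>
    by (intro hull_minimal) (auto simp: axis_def)
  then show "(\<Sum>j\<in>R. p $ j) = 1" using assms by auto
qed

text \<open>Representatives are sought for \<open>k\<close> copies of every \<open>S\<close>, with
  \<open>\<alpha>\<close> as prescribed multiplicities; writing \<open>\<alpha>\<close> as
  \<open>k\<close> times a sum of points of the simplices verifies the bounds.\<close>

lemma lattice_point_dilation_decompose:
  fixes B :: "'n::finite set set"
  assumes "\<alpha> \<in> lattice_points ((\<lambda>x. real k *\<^sub>R x) ` nestohedron B)"
  shows "\<exists>\<phi>. (\<forall>l\<in>{1..k}. \<forall>S\<in>B. \<phi> l S \<in> S) \<and> \<alpha> = (\<Sum>l=1..k. choice_point B (\<phi> l))"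
proof -
  obtain p where p: "\<And>S. S \<in> B \<Longrightarrow> p S \<in> simplex_of S"
    and \<alpha>: "real_vec \<alpha> = real k *\<^sub>R (\<Sum>S\<in>B. p S)"
    using assms by (auto simp: lattice_points_def nestohedron_def set_sum_alt)
  have \<alpha>R: "real_of_int (\<Sum>j\<in>R. \<alpha> $ j) = real k * (\<Sum>S\<in>B. \<Sum>j\<in>R. p S $ j)" for R
  proof -
    have "real_of_int (\<alpha> $ j) = real k * (\<Sum>S\<in>B. p S $ j)" for j
      using arg_cong[OF \<alpha>, of "\<lambda>v. v $ j"] by (simp add: real_vec_def)
    then show ?thesis
      by (simp add: sum_distrib_left) (rule sum.swap)
  qed
  let ?X = "B \<times> {1..k}"
  have "\<exists>f. (\<forall>r\<in>?X. f r \<in> fst r) \<and> (\<forall>j. int (card {r\<in>?X. f r = j}) = \<alpha> $ j)"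
  proof (rule system_of_representatives_exact)
    show "finite ?X" by simp
    have "(\<Sum>S\<in>B. \<Sum>j\<in>UNIV. p S $ j) = real (card B)"
      using simplex_of_bounds(2)[OF p] by simp
    then show "(\<Sum>j\<in>UNIV. \<alpha> $ j) = int (card ?X)"
      using \<alpha>R[of UNIV]
      by (metis card_atLeastAtMost card_cartesian_product diff_Suc_1 mult.commute of_int_eq_iff of_int_of_nat_eq of_nat_mult)
    fix R :: "'n set"
    have "{r\<in>?X. fst r \<subseteq> R} = {S\<in>B. S \<subseteq> R} \<times> {1..k}" by auto
    \<comment> \<open>Each \<open>S\<close> inside \<open>R\<close> contributes exactly 1 through
      \<open>p S\<close>, and the other members of \<open>B\<close> contribute at least 0.\<close>
    then have "real (card {r\<in>?X. fst r \<subseteq> R}) = real k * (\<Sum>S\<in>{S\<in>B. S \<subseteq> R}. 1)"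
      by (simp add: card_cartesian_product)
    also have "\<dots> = real k * (\<Sum>S\<in>{S\<in>B. S \<subseteq> R}. \<Sum>j\<in>R. p S $ j)"
      using simplex_of_bounds(2)[OF p] by simp
    also have "\<dots> \<le> real k * (\<Sum>S\<in>B. \<Sum>j\<in>R. p S $ j)"
      using simplex_of_bounds(1)[OF p] by (intro mult_left_mono sum_mono2) auto
    also have "\<dots> = real_of_int (\<Sum>j\<in>R. \<alpha> $ j)" by (simp only: \<alpha>R)
    finally show "int (card {r\<in>?X. fst r \<subseteq> R}) \<le> (\<Sum>j\<in>R. \<alpha> $ j)" by linarith
  qed
  then obtain f where f: "\<And>S l. S \<in> B \<Longrightarrow> l \<in> {1..k} \<Longrightarrow> f (S, l) \<in> S"
    "\<And>j. int (card {r\<in>?X. f r = j}) = \<alpha> $ j" by fastforce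
  \<comment> \<open>Coordinate \<open>j\<close> counts the entries equal to \<open>j\<close>, first
    row by row and then over all pairs \<open>(S, l)\<close>.\<close>
  have "(\<Sum>l=1..k. choice_point B (\<lambda>S. f (S, l))) $ j = \<alpha> $ j" for j
  proof -
    have "(\<Sum>l=1..k. choice_point B (\<lambda>S. f (S, l))) $ j = (\<Sum>l=1..k. \<Sum>S\<in>B. if j = f (S, l) then 1 else 0)"
      by (simp add: choice_point_def axis_def)
    also have "\<dots> = (\<Sum>S\<in>B. \<Sum>l=1..k. if j = f (S, l) then 1 else 0)" by (rule sum.swap)
    also have "\<dots> = (\<Sum>r\<in>?X. if j = f r then 1 else 0)"
      by (simp add: sum.cartesian_product)
    also have "\<dots> = int (card {r\<in>?X. f r = j})"
      by (simp add: sum.If_cases Int_def eq_commute[of j])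
    finally show ?thesis using f by simp
  qed
  then show ?thesis
    using f(1) by (intro exI[of _ "\<lambda>l S. f (S, l)"]) (simp add: vec_eq_iff)
qed

text \<open>Decomposition with dilation factor 1 gives the harder inclusion.\<close>

lemma lattice_points_nestohedron:
  "lattice_points (nestohedron B) = {choice_point B f | f. \<forall>S\<in>B. f S \<in> S}"
proof
  show "{choice_point B f | f. \<forall>S\<in>B. f S \<in> S} \<subseteq> lattice_points (nestohedron B)"
    using choice_point_in_nestohedron by blast
  show "lattice_points (nestohedron B) \<subseteq> {choice_point B f | f. \<forall>S\<in>B. f S \<in> S}"
    using lattice_point_dilation_decompose[of _ 1 B] by fastforce
qed

lemma integer_decomposition_property_nestohedron:
  "integer_decomposition_property (nestohedron B)"
  unfolding integer_decomposition_property_def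
proof (intro conjI allI impI ballI)
  show "lattice_polytope (nestohedron B)" by (rule lattice_polytope_nestohedron)
  fix k \<alpha>
  assume "\<alpha> \<in> lattice_points ((\<lambda>x. real k *\<^sub>R x) ` nestohedron B)"
  from lattice_point_dilation_decompose[OF this] obtain \<phi>
    where "\<forall>l\<in>{1..k}. \<forall>S\<in>B. \<phi> l S \<in> S" "\<alpha> = (\<Sum>l=1..k. choice_point B (\<phi> l))"
    by blast
  then show "\<exists>\<beta>. (\<forall>j\<in>{1..k}. \<beta> j \<in> lattice_points (nestohedron B)) \<and> \<alpha> = (\<Sum>j=1..k. \<beta> j)"
    by (intro exI[of _ "\<lambda>l. choice_point B (\<phi> l)"]) (auto simp: choice_point_in_nestohedron)
qed

section \<open>Toric kernels and connectivity by quadratic moves\<close>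

text \<open>The exponent of the Laurent monomial that is the image of the monomial \<open>u\<close>.
  The inner sum is a natural multiple of \<open>a\<close>, written as repeated addition in an
  abelian group.\<close>

definition toric_weight :: "('e::ab_group_add \<Rightarrow>\<^sub>0 nat) \<Rightarrow> 'e" where
  "toric_weight u = (\<Sum>a\<in>Poly_Mapping.keys u. \<Sum>_<Poly_Mapping.lookup u a. a)"

lemma toric_weight_superset:
  assumes "finite X" "Poly_Mapping.keys u \<subseteq> X"
  shows "toric_weight u = (\<Sum>a\<in>X. \<Sum>_<Poly_Mapping.lookup u a. a)"
  unfolding toric_weight_def
  using assms by (intro sum.mono_neutral_left) (auto simp: in_keys_iff)

lemma toric_weight_add: "toric_weight (u + v) = toric_weight u + toric_weight v"
proof -
  let ?X = "Poly_Mapping.keys u \<union> Poly_Mapping.keys v"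
  have const: "(\<Sum>_<m + n. a) = (\<Sum>_<m. a) + (\<Sum>_<n. a)" for m n :: nat and a :: 'a
    by (induction n) (simp_all add: add.assoc)
  have "toric_weight (u + v) = (\<Sum>a\<in>?X. \<Sum>_<Poly_Mapping.lookup (u + v) a. a)"
    by (rule toric_weight_superset) (auto dest: keys_add[THEN subsetD])
  also have "\<dots> = toric_weight u + toric_weight v"
    by (simp add: toric_weight_superset[of ?X] lookup_add const sum.distrib)
  finally show ?thesis .
qed

lemma toric_weight_zero: "toric_weight 0 = 0"
  by (simp add: toric_weight_def)

lemma toric_weight_single: "toric_weight (Poly_Mapping.single a 1) = a"
  by (simp add: toric_weight_def)

lemma toric_weight_sum: "toric_weight (\<Sum>i\<in>I. u i) = (\<Sum>i\<in>I. toric_weight (u i))"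
  by (induction I rule: infinite_finite_induct) (auto simp: toric_weight_zero toric_weight_add)

section \<open>The toric map as a ring homomorphism\<close>

text \<open>The elements \<open>single a 1\<close> multiply by adding exponents, so each monomial
  has a single Laurent monomial as its image.\<close>

lemma toric_map_eq:
  fixes f :: "('e::ab_group_add, 'k::field) polynomial"
  shows "toric_map f =
    (\<Sum>u\<in>Poly_Mapping.keys f. Poly_Mapping.single (toric_weight u) (Poly_Mapping.lookup f u))"
proof -
  have pow: "Poly_Mapping.single a (1::'k) ^ n = Poly_Mapping.single (\<Sum>_<n. a) 1" for a :: 'e and n
    by (induction n) (simp_all add: mult_single add.commute)
  have "(\<Prod>a\<in>X. Poly_Mapping.single (h a) (1::'k)) = Poly_Mapping.single (sum h X) 1"
    for X :: "'e set" and h :: "'e \<Rightarrow> 'e"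
    by (induction X rule: infinite_finite_induct) (simp_all add: mult_single)
  then show ?thesis
    by (simp add: toric_map_def pow mult_single toric_weight_def)
qed

lemma toric_map_superset:
  assumes "finite X" "Poly_Mapping.keys f \<subseteq> X"
  shows "toric_map f = (\<Sum>u\<in>X. Poly_Mapping.single (toric_weight u) (Poly_Mapping.lookup f u))"
  unfolding toric_map_eq
  using assms by (intro sum.mono_neutral_left) (auto simp: in_keys_iff)

lemma toric_map_zero: "toric_map 0 = 0"
  by (simp add: toric_map_eq)

lemma toric_map_add: "toric_map (f + g) = toric_map f + toric_map g"
proof -
  let ?X = "Poly_Mapping.keys f \<union> Poly_Mapping.keys g"
  have "toric_map (f + g) =
      (\<Sum>u\<in>?X. Poly_Mapping.single (toric_weight u) (Poly_Mapping.lookup (f + g) u))"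
    by (rule toric_map_superset) (auto dest: keys_add[THEN subsetD])
  also have "\<dots> = toric_map f + toric_map g"
    by (simp add: toric_map_superset[of ?X] lookup_add single_add sum.distrib)
  finally show ?thesis .
qed

lemma toric_map_diff: "toric_map (f - g) = toric_map f - toric_map g"
  using toric_map_add[of "f - g" g] by simp

lemma toric_map_sum: "toric_map (\<Sum>i\<in>I. f i) = (\<Sum>i\<in>I. toric_map (f i))"
  by (induction I rule: infinite_finite_induct) (auto simp: toric_map_zero toric_map_add)

lemma toric_map_single:
  "toric_map (Poly_Mapping.single u c) = Poly_Mapping.single (toric_weight u) c"
  by (cases "c = 0") (simp_all add: toric_map_eq)

lemma sum_single_lookup:
  "(\<Sum>u\<in>Poly_Mapping.keys f. Poly_Mapping.single u (Poly_Mapping.lookup f u)) = f"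
  by (rule poly_mapping_eqI) (simp add: lookup_sum lookup_single when_def in_keys_iff)

text \<open>Expanding both factors into monomials reduces multiplicativity to additivity of the
  weight.\<close>

lemma toric_map_mult: "toric_map (f * g) = toric_map f * toric_map g"
proof -
  have "toric_map (f * g) =
      toric_map ((\<Sum>u\<in>Poly_Mapping.keys f. Poly_Mapping.single u (Poly_Mapping.lookup f u)) *
                 (\<Sum>v\<in>Poly_Mapping.keys g. Poly_Mapping.single v (Poly_Mapping.lookup g v)))"
    by (simp only: sum_single_lookup)
  also have "\<dots> = toric_map f * toric_map g"
    by (simp add: sum_product toric_map_sum mult_single toric_map_single toric_weight_add toric_map_eq[of f] toric_map_eq[of g])
  finally show ?thesis .
qed

section \<open>Closure properties of polynomial rings and generated ideals\<close>

lemma polynomials_in_single: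
  "Poly_Mapping.keys u \<subseteq> A \<Longrightarrow> Poly_Mapping.single u c \<in> polynomials_in A"
  by (auto simp: polynomials_in_def)

lemma polynomials_in_zero: "0 \<in> polynomials_in A"
  by (simp add: polynomials_in_def)

lemma polynomials_in_add:
  "f \<in> polynomials_in A \<Longrightarrow> g \<in> polynomials_in A \<Longrightarrow> f + g \<in> polynomials_in A"
  using keys_add[of f g] by (auto simp: polynomials_in_def)

lemma polynomials_in_diff:
  "f \<in> polynomials_in A \<Longrightarrow> g \<in> polynomials_in A \<Longrightarrow> f - g \<in> polynomials_in A"
  using keys_diff[of f g] by (auto simp: polynomials_in_def)

lemma polynomials_in_mult:
  assumes "f \<in> polynomials_in A" "g \<in> polynomials_in A"
  shows "f * g \<in> polynomials_in A"
  unfolding polynomials_in_def mem_Collect_eq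
proof
  fix u assume "u \<in> Poly_Mapping.keys (f * g)"
  then obtain v w where "u = v + w" "v \<in> Poly_Mapping.keys f" "w \<in> Poly_Mapping.keys g"
    using keys_mult[of f g] by blast
  then show "Poly_Mapping.keys u \<subseteq> A"
    using assms keys_add[of v w] by (fastforce simp: polynomials_in_def)
qed

lemma polynomials_in_sum:
  "(\<And>i. i \<in> I \<Longrightarrow> f i \<in> polynomials_in A) \<Longrightarrow> (\<Sum>i\<in>I. f i) \<in> polynomials_in A"
  by (induction I rule: infinite_finite_induct)
     (simp_all add: polynomials_in_zero polynomials_in_add)

lemma ideal_generated_in_zero: "0 \<in> ideal_generated_in R G"
  unfolding ideal_generated_in_def by (intro CollectI exI[of _ "{}"]) auto

lemma ideal_generated_in_smult_gen:
  "g \<in> G \<Longrightarrow> c \<in> R \<Longrightarrow> c * g \<in> ideal_generated_in R G"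
  unfolding ideal_generated_in_def
  by (intro CollectI exI[of _ "{g}"] exI[of _ "\<lambda>_. c"]) auto

lemma ideal_generated_in_add:
  assumes x: "x \<in> ideal_generated_in R G" and y: "y \<in> ideal_generated_in R G"
    and R: "0 \<in> R" "\<And>a b. a \<in> R \<Longrightarrow> b \<in> R \<Longrightarrow> a + b \<in> R"
  shows "x + y \<in> ideal_generated_in R G"
proof -
  obtain F c where F: "x = (\<Sum>g\<in>F. c g * g)" "finite F" "F \<subseteq> G" "\<forall>g\<in>F. c g \<in> R"
    using x by (auto simp: ideal_generated_in_def)
  obtain F' c' where F': "y = (\<Sum>g\<in>F'. c' g * g)" "finite F'" "F' \<subseteq> G" "\<forall>g\<in>F'. c' g \<in> R"
    using y by (auto simp: ideal_generated_in_def)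
  \<comment> \<open>Coefficients extended by 0 allow both combinations to be taken over
    \<open>F \<union> F'\<close>, where common generators have their coefficients added.\<close>
  define d where "d g = (if g \<in> F then c g else 0)" for g
  define d' where "d' g = (if g \<in> F' then c' g else 0)" for g
  have "x = (\<Sum>g\<in>F \<union> F'. d g * g)" "y = (\<Sum>g\<in>F \<union> F'. d' g * g)"
    unfolding F F' using F(2) F'(2)
    by (auto intro!: sum.mono_neutral_cong_left simp: d_def d'_def)
  then have "x + y = (\<Sum>g\<in>F \<union> F'. (d g + d' g) * g)"
    by (simp add: sum.distrib distrib_right)
  moreover have "\<forall>g\<in>F \<union> F'. d g + d' g \<in> R"
    using F F' R by (auto simp: d_def d'_def)
  ultimately show ?thesis
    unfolding ideal_generated_in_def using F F'
    by (intro CollectI exI[of _ "F \<union> F'"] exI[of _ "\<lambda>g. d g + d' g"]) auto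
qed

lemma ideal_generated_in_mult:
  assumes "x \<in> ideal_generated_in R G" "a \<in> R" "\<And>a b. a \<in> R \<Longrightarrow> b \<in> R \<Longrightarrow> a * b \<in> R"
  shows "a * x \<in> ideal_generated_in R G"
proof -
  obtain F c where F: "x = (\<Sum>g\<in>F. c g * g)" "finite F" "F \<subseteq> G" "\<forall>g\<in>F. c g \<in> R"
    using assms(1) by (auto simp: ideal_generated_in_def)
  then have "a * x = (\<Sum>g\<in>F. (a * c g) * g)"
    by (simp add: sum_distrib_left mult.assoc)
  then show ?thesis
    unfolding ideal_generated_in_def using F assms(2,3)
    by (intro CollectI exI[of _ F] exI[of _ "\<lambda>g. a * c g"]) auto
qed

lemma ideal_generated_in_sum:
  assumes "\<And>i. i \<in> I \<Longrightarrow> f i \<in> ideal_generated_in R G"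
    and R: "0 \<in> R" "\<And>a b. a \<in> R \<Longrightarrow> b \<in> R \<Longrightarrow> a + b \<in> R"
  shows "(\<Sum>i\<in>I. f i) \<in> ideal_generated_in R G"
  using assms(1)
  by (induction I rule: infinite_finite_induct)
     (auto simp: ideal_generated_in_zero intro!: ideal_generated_in_add R)

section \<open>Quadratic moves and the ideal of quadratic binomials\<close>

text \<open>Here \<open>w\<close> is the common cofactor of the two monomials. The pairs
  \<open>a, b\<close> and \<open>c, d\<close> may coincide, so trivial moves are included.\<close>

inductive quadratic_move :: "'e::ab_group_add set \<Rightarrow> ('e \<Rightarrow>\<^sub>0 nat) \<Rightarrow> ('e \<Rightarrow>\<^sub>0 nat) \<Rightarrow> bool" for A where
  "{a, b, c, d} \<subseteq> A \<Longrightarrow> a + b = c + d \<Longrightarrow> Poly_Mapping.keys w \<subseteq> A \<Longrightarrow>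
   quadratic_move A (w + (Poly_Mapping.single a 1 + Poly_Mapping.single b 1))
                    (w + (Poly_Mapping.single c 1 + Poly_Mapping.single d 1))"

definition toric_quadrics :: "'e::ab_group_add set \<Rightarrow> ('e, 'k::field) polynomial set" where
  "toric_quadrics A = {g \<in> polynomials_in A. quadratic_binomial g \<and> toric_map g = 0}"

lemma monomial_degree_pair:
  "monomial_degree (Poly_Mapping.single a 1 + Poly_Mapping.single b 1) = 2"
proof -
  have keys: "Poly_Mapping.keys (Poly_Mapping.single a (1::nat) + Poly_Mapping.single b 1) = {a, b}"
    by (auto simp: in_keys_iff lookup_add lookup_single when_def split: if_splits)
  show ?thesis
    unfolding monomial_degree_def keys
    by (cases "a = b") (auto simp: lookup_add lookup_single)
qed

text \<open>The difference of the two monomials is the cofactor \<open>single w 1\<close> times a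
  difference of two monomials of degree 2 and equal weight.\<close>

lemma quadratic_move_ideal:
  assumes "quadratic_move A u v"
  shows "Poly_Mapping.single u 1 - Poly_Mapping.single v (1::'k::field) \<in>
    ideal_generated_in (polynomials_in A) (toric_quadrics A)"
  using assms
proof cases
  case (1 a b c d w)
  let ?p = "Poly_Mapping.single a 1 + Poly_Mapping.single b (1::nat)"
  let ?q = "Poly_Mapping.single c 1 + Poly_Mapping.single d (1::nat)"
  let ?g = "Poly_Mapping.single ?p (1::'k) - Poly_Mapping.single ?q 1"
  have eq: "Poly_Mapping.single u 1 - Poly_Mapping.single v (1::'k) = Poly_Mapping.single w 1 * ?g"
    by (simp add: 1 right_diff_distrib mult_single)
  show ?thesis
  \<comment> \<open>A trivial move gives 0, which is not a \<open>quadratic_binomial\<close> and is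
    treated apart.\<close>
  proof (cases "?p = ?q")
    case True
    then show ?thesis unfolding eq by (simp add: ideal_generated_in_zero)
  next
    case False
    have "?g \<in> polynomials_in A"
      using 1(3) keys_add[of "Poly_Mapping.single a (1::nat)" "Poly_Mapping.single b 1"]
        keys_add[of "Poly_Mapping.single c (1::nat)" "Poly_Mapping.single d 1"]
      by (intro polynomials_in_diff polynomials_in_single) auto
    moreover have "quadratic_binomial ?g"
      unfolding quadratic_binomial_def
      by (rule exI[of _ ?p], rule exI[of _ ?q]) (intro conjI False monomial_degree_pair refl)
    moreover have "toric_map ?g = 0"
      using 1(4)
      by (simp add: toric_map_diff toric_map_single toric_weight_add toric_weight_single del: One_nat_def)
    ultimately have "?g \<in> toric_quadrics A"
      by (simp add: toric_quadrics_def)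
    then show ?thesis
      unfolding eq using 1(5) by (intro ideal_generated_in_smult_gen polynomials_in_single)
  qed
qed

text \<open>The difference telescopes along the chain of moves.\<close>

lemma quadratic_moves_ideal:
  assumes "(quadratic_move A)\<^sup>*\<^sup>* u v"
  shows "Poly_Mapping.single u 1 - Poly_Mapping.single v (1::'k::field) \<in>
    ideal_generated_in (polynomials_in A) (toric_quadrics A)"
  using assms
proof induction
  case base
  then show ?case by (simp add: ideal_generated_in_zero)
next
  case (step v w)
  from ideal_generated_in_add[OF step.IH quadratic_move_ideal[OF step.hyps(2)]]
  show ?case by (simp add: polynomials_in_zero polynomials_in_add)
qed

text \<open>Modulo binomials with monomials of equal weight, a polynomial is a combination of one
  representative monomial per weight, and the coefficients are those of its image.\<close>

lemma toric_kernel_eq_ideal: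
  fixes A :: "'e::ab_group_add set"
  assumes connected: "\<And>u v. Poly_Mapping.keys u \<subseteq> A \<Longrightarrow> Poly_Mapping.keys v \<subseteq> A \<Longrightarrow>
      toric_weight u = toric_weight v \<Longrightarrow> (quadratic_move A)\<^sup>*\<^sup>* u v"
  shows "{f \<in> polynomials_in A. toric_map f = (0 :: 'e \<Rightarrow>\<^sub>0 'k::field)} =
    ideal_generated_in (polynomials_in A) (toric_quadrics A)" (is "?K = ?I")
proof
  show "?I \<subseteq> ?K"
  proof
    fix f :: "('e, 'k) polynomial" assume "f \<in> ?I"
    then obtain F c where F: "f = (\<Sum>g\<in>F. c g * g)" "F \<subseteq> toric_quadrics A"
      "\<forall>g\<in>F. c g \<in> polynomials_in A"
      by (auto simp: ideal_generated_in_def)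
    then have "g \<in> F \<Longrightarrow> g \<in> polynomials_in A \<and> toric_map g = 0" for g
      by (auto simp: toric_quadrics_def)
    with F show "f \<in> ?K"
      by (auto simp: toric_map_sum toric_map_mult intro!: polynomials_in_sum polynomials_in_mult)
  qed
  show "?K \<subseteq> ?I"
  proof
    fix f :: "('e, 'k) polynomial" assume "f \<in> ?K"
    then have f: "\<And>u. u \<in> Poly_Mapping.keys f \<Longrightarrow> Poly_Mapping.keys u \<subseteq> A" "toric_map f = 0"
      by (auto simp: polynomials_in_def)
    let ?U = "Poly_Mapping.keys f"
    \<comment> \<open>One monomial per weight, chosen among those of \<open>f\<close> itself, so
      that its variables lie in \<open>A\<close>.\<close>
    define r where "r e = (SOME u. u \<in> ?U \<and> toric_weight u = e)" for e
    have r: "r (toric_weight u) \<in> ?U \<and> toric_weight (r (toric_weight u)) = toric_weight u"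
      if "u \<in> ?U" for u
      unfolding r_def by (rule someI[of _ u]) (use that in simp)
    \<comment> \<open>Moving every coefficient to its representative yields 0: the total at weight
      \<open>e\<close> is the coefficient of \<open>toric_map f\<close> at \<open>e\<close>.\<close>
    have "(\<Sum>u\<in>?U. Poly_Mapping.single (r (toric_weight u)) (Poly_Mapping.lookup f u)) =
        (\<Sum>e\<in>toric_weight ` ?U. \<Sum>u\<in>{u\<in>?U. toric_weight u = e}.
          Poly_Mapping.single (r (toric_weight u)) (Poly_Mapping.lookup f u))"
      by (rule sum.image_gen) simp
    also have "\<dots> = 0"
    proof (rule sum.neutral, rule ballI)
      fix e
      have "(\<Sum>u\<in>{u\<in>?U. toric_weight u = e}. Poly_Mapping.single (r (toric_weight u)) (Poly_Mapping.lookup f u))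
          = (\<Sum>u\<in>{u\<in>?U. toric_weight u = e}. Poly_Mapping.single (r e) (Poly_Mapping.lookup f u))"
        by (rule sum.cong) auto
      also have "\<dots> = Poly_Mapping.single (r e) (\<Sum>u\<in>{u\<in>?U. toric_weight u = e}. Poly_Mapping.lookup f u)"
        by (rule poly_mapping_eqI) (simp add: lookup_sum lookup_single when_def)
      also have "(\<Sum>u\<in>{u\<in>?U. toric_weight u = e}. Poly_Mapping.lookup f u) = Poly_Mapping.lookup (toric_map f) e"
        by (simp add: toric_map_eq lookup_sum lookup_single when_def sum.inter_filter)
      finally show "(\<Sum>u\<in>{u\<in>?U. toric_weight u = e}. Poly_Mapping.single (r (toric_weight u)) (Poly_Mapping.lookup f u)) = 0"
        by (simp add: f)
    qed
    \<comment> \<open>Thus \<open>f\<close> is a combination of differences of monomials of equal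
      weight, each in the ideal by connectivity.\<close>
    finally have "f = (\<Sum>u\<in>?U. Poly_Mapping.single u (Poly_Mapping.lookup f u)) -
        (\<Sum>u\<in>?U. Poly_Mapping.single (r (toric_weight u)) (Poly_Mapping.lookup f u))"
      by (simp add: sum_single_lookup)
    also have "\<dots> = (\<Sum>u\<in>?U. Poly_Mapping.single 0 (Poly_Mapping.lookup f u) *
        (Poly_Mapping.single u 1 - Poly_Mapping.single (r (toric_weight u)) 1))"
      by (simp add: right_diff_distrib mult_single sum_subtractf)
    also have "\<dots> \<in> ?I"
    proof (intro ideal_generated_in_sum ideal_generated_in_mult quadratic_moves_ideal)
      fix u assume u: "u \<in> ?U"
      show "(quadratic_move A)\<^sup>*\<^sup>* u (r (toric_weight u))"
        using r[OF u] f(1) u by (intro connected) auto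
    qed (auto intro: polynomials_in_zero polynomials_in_add polynomials_in_mult polynomials_in_single)
    finally show "f \<in> ?I" .
  qed
qed

section \<open>Tables of choices\<close>

definition choice_table :: "'n::finite set set \<Rightarrow> nat \<Rightarrow> (nat \<Rightarrow> 'n set \<Rightarrow> 'n) \<Rightarrow> bool" where
  "choice_table B k \<phi> \<longleftrightarrow> (\<forall>l<k. \<forall>S\<in>B. \<phi> l S \<in> S)"

text \<open>Only the points of the rows enter, so changing a row without changing its point leaves
  the monomial the same.\<close>

definition table_monomial ::
    "'n::finite set set \<Rightarrow> nat \<Rightarrow> (nat \<Rightarrow> 'n set \<Rightarrow> 'n) \<Rightarrow> 'n exponent \<Rightarrow>\<^sub>0 nat" where
  "table_monomial B k \<phi> = (\<Sum>l<k. Poly_Mapping.single (choice_point B (\<phi> l), 1) 1)"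

definition col_count :: "nat \<Rightarrow> (nat \<Rightarrow> 's \<Rightarrow> 'n) \<Rightarrow> 's \<Rightarrow> 'n \<Rightarrow> nat" where
  "col_count k \<phi> S j = card {l. l < k \<and> \<phi> l S = j}"

lemma choice_point_cong:
  "(\<And>S. S \<in> B \<Longrightarrow> f S = g S) \<Longrightarrow> choice_point B f = choice_point B g"
  by (simp add: choice_point_def)

lemma choice_point_upd:
  assumes "S \<in> B"
  shows "choice_point B (f(S := x)) = choice_point B f - axis (f S) 1 + axis x 1"
proof -
  have "(\<Sum>T\<in>B - {S}. axis ((f(S := x)) T) 1) = (\<Sum>T\<in>B - {S}. axis (f T) (1::int))"
    by (rule sum.cong) auto
  then show ?thesis
    using sum.remove[OF _ assms, of "\<lambda>T. axis (f T) (1::int)"]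
      sum.remove[OF _ assms, of "\<lambda>T. axis ((f(S := x)) T) (1::int)"]
    by (simp add: choice_point_def)
qed

lemma toric_configuration_nestohedron:
  "toric_configuration (nestohedron B) = {(choice_point B f, 1) | f. \<forall>S\<in>B. f S \<in> S}"
  by (auto simp: toric_configuration_def lattice_points_nestohedron)

lemma col_count_posD: "0 < col_count k \<phi> S j \<Longrightarrow> \<exists>l<k. \<phi> l S = j"
  by (auto simp: col_count_def card_gt_0_iff)

lemma sum_col_count:
  fixes \<phi> :: "nat \<Rightarrow> 's \<Rightarrow> 'n::finite"
  shows "(\<Sum>j\<in>UNIV. col_count k \<phi> S j) = k"
  using sum.group[of "{..<k}" UNIV "\<lambda>l. \<phi> l S" "\<lambda>_. 1::nat"]
  by (simp add: col_count_def lessThan_def)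

text \<open>Double counting of the entries \<open>j\<close>, by rows and by columns. Equal sums of
  points thus mean equal totals over all columns, while single columns may differ.\<close>

lemma sum_choice_point_nth:
  "(\<Sum>l<k. choice_point B (\<phi> l)) $ j = int (\<Sum>S\<in>B. col_count k \<phi> S j)"
proof -
  have "(\<Sum>l<k. choice_point B (\<phi> l)) $ j = (\<Sum>l<k. \<Sum>S\<in>B. if j = \<phi> l S then 1 else 0)"
    by (simp add: choice_point_def axis_def)
  also have "\<dots> = (\<Sum>S\<in>B. \<Sum>l<k. if j = \<phi> l S then 1 else 0)" by (rule sum.swap)
  also have "\<dots> = (\<Sum>S\<in>B. int (col_count k \<phi> S j))"
    by (simp add: sum.If_cases Int_def col_count_def eq_commute[of j])
  finally show ?thesis by simp
qed

text \<open>Each column \<open>T\<close> has its own permutation \<open>\<sigma> T\<close> of the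
  rows; it maps the new occurrences of an entry bijectively to the old ones.\<close>

lemma col_count_permute:
  assumes "bij_betw (\<sigma> S) {..<k} {..<k}"
  shows "col_count k (\<lambda>l T. \<phi> (\<sigma> T l) T) S j = col_count k \<phi> S j"
proof -
  have "bij_betw (\<sigma> S) {l. l < k \<and> \<phi> (\<sigma> S l) S = j} {l. l < k \<and> \<phi> l S = j}"
    unfolding bij_betw_def
  proof
    show "inj_on (\<sigma> S) {l. l < k \<and> \<phi> (\<sigma> S l) S = j}"
      using assms by (auto simp: bij_betw_def intro: inj_on_subset)
    have "\<sigma> S ` {..<k} = {..<k}" using assms by (simp add: bij_betw_def)
    moreover have "\<sigma> S ` {l \<in> {..<k}. \<phi> (\<sigma> S l) S = j} = {l \<in> \<sigma> S ` {..<k}. \<phi> l S = j}"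
      by blast
    ultimately show "\<sigma> S ` {l. l < k \<and> \<phi> (\<sigma> S l) S = j} = {l. l < k \<and> \<phi> l S = j}"
      by simp
  qed
  then show ?thesis unfolding col_count_def by (rule bij_betw_same_card)
qed

section \<open>Tables with equal column counts\<close>

lemma bij_betw_transpose_lessThan:
  "l < k \<Longrightarrow> l' < k \<Longrightarrow> bij_betw (Transposition.transpose l l') {..<k} {..<k}"
  by (rule bij_betw_byWitness[where f' = "Transposition.transpose l l'"])
     (auto simp: Transposition.transpose_def)

text \<open>Both exchanged entries lie in \<open>S\<close>, so the new rows are again choices, and
  their points change by opposite vectors.\<close>

lemma quadratic_move_swap:
  fixes B :: "'n::finite set set"
  assumes \<phi>: "choice_table B k \<phi>" and "S \<in> B" and l: "l < k" "l' < k" "l \<noteq> l'"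
  shows "quadratic_move (toric_configuration (nestohedron B)) (table_monomial B k \<phi>)
    (table_monomial B k (\<phi>(l := (\<phi> l)(S := \<phi> l' S), l' := (\<phi> l')(S := \<phi> l S))))"
    (is "quadratic_move ?A _ (table_monomial B k ?\<psi>)")
proof -
  define w where "w = (\<Sum>m\<in>{..<k} - {l, l'}. Poly_Mapping.single (choice_point B (\<phi> m), 1::int) (1::nat))"
  have split: "(\<Sum>m<k. h m) = (\<Sum>m\<in>{..<k} - {l, l'}. h m) + (h l + h l')" for h :: "nat \<Rightarrow> 'n exponent \<Rightarrow>\<^sub>0 nat"
    using l sum.subset_diff[of "{l, l'}" "{..<k}" h] by simp
  have 1: "table_monomial B k \<phi> =
      w + (Poly_Mapping.single (choice_point B (\<phi> l), 1) 1 + Poly_Mapping.single (choice_point B (\<phi> l'), 1) 1)"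
    unfolding table_monomial_def w_def by (rule split)
  have 2: "table_monomial B k ?\<psi> =
      w + (Poly_Mapping.single (choice_point B (?\<psi> l), 1) 1 + Poly_Mapping.single (choice_point B (?\<psi> l'), 1) 1)"
    unfolding table_monomial_def w_def split by (intro arg_cong2[of _ _ _ _ "(+)"] sum.cong) auto
  have in_A: "(choice_point B f, 1) \<in> ?A" if "\<forall>S\<in>B. f S \<in> S" for f
    using that by (auto simp: toric_configuration_nestohedron)
  show ?thesis
    unfolding 1 2
  proof (rule quadratic_move.intros)
    show "{(choice_point B (\<phi> l), 1), (choice_point B (\<phi> l'), 1),
        (choice_point B (?\<psi> l), 1), (choice_point B (?\<psi> l'), 1)} \<subseteq> ?A"
      using \<phi> l \<open>S \<in> B\<close> by (auto simp: choice_table_def intro!: in_A)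
    show "(choice_point B (\<phi> l), 1::int) + (choice_point B (\<phi> l'), 1) =
        (choice_point B (?\<psi> l), 1) + (choice_point B (?\<psi> l'), 1)"
      using l \<open>S \<in> B\<close> by (simp add: choice_point_upd)
    have "Poly_Mapping.keys w \<subseteq> (\<Union>m\<in>{..<k} - {l, l'}. {(choice_point B (\<phi> m), 1)})"
      unfolding w_def by (rule order_trans[OF keys_sum]) auto
    also have "\<dots> \<subseteq> ?A"
      using \<phi> by (auto simp: choice_table_def intro!: in_A)
    finally show "Poly_Mapping.keys w \<subseteq> ?A" .
  qed
qed

text \<open>Induction on the number of cells where the tables disagree; each swap repairs a cell and
  spoils none.\<close>

lemma connected_if_col_count_eq:
  fixes B :: "'n::finite set set"
  assumes "choice_table B k \<phi>" "choice_table B k \<psi>"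
    and "\<And>S j. S \<in> B \<Longrightarrow> col_count k \<phi> S j = col_count k \<psi> S j"
  shows "(quadratic_move (toric_configuration (nestohedron B)))\<^sup>*\<^sup>*
    (table_monomial B k \<phi>) (table_monomial B k \<psi>)"
  using assms(1,3)
proof (induction "card {(l, S). l < k \<and> S \<in> B \<and> \<phi> l S \<noteq> \<psi> l S}" arbitrary: \<phi> rule: less_induct)
  case less
  have finite: "finite {(l, S). l < k \<and> S \<in> B \<and> \<phi> l S \<noteq> \<psi> l S}" for \<phi>
    by (rule finite_subset[of _ "{..<k} \<times> B"]) auto
  show ?case
  proof (cases "\<forall>l<k. \<forall>S\<in>B. \<phi> l S = \<psi> l S")
    case True
    then have "table_monomial B k \<phi> = table_monomial B k \<psi>"
      unfolding table_monomial_def by (intro sum.cong) (auto cong: choice_point_cong)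
    then show ?thesis by simp
  next
    case False
    then obtain l S where l: "l < k" "S \<in> B" "\<phi> l S \<noteq> \<psi> l S" by blast
    \<comment> \<open>The entry \<open>\<psi> l S\<close> is equally frequent in column
      \<open>S\<close> of both tables. Since row \<open>l\<close> has it only in
      \<open>\<psi>\<close>, some other row has it only in \<open>\<phi>\<close>.\<close>
    have "\<not> {m. m < k \<and> \<phi> m S = \<psi> l S} \<subseteq> {m. m < k \<and> \<psi> m S = \<psi> l S}"
    proof
      assume "{m. m < k \<and> \<phi> m S = \<psi> l S} \<subseteq> {m. m < k \<and> \<psi> m S = \<psi> l S}"
      then have "{m. m < k \<and> \<phi> m S = \<psi> l S} = {m. m < k \<and> \<psi> m S = \<psi> l S}"
        using less.prems(2)[OF l(2), of "\<psi> l S"] by (intro card_subset_eq) (auto simp: col_count_def)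
      then show False using l by blast
    qed
    then obtain l' where l': "l' < k" "\<phi> l' S = \<psi> l S" "\<psi> l' S \<noteq> \<psi> l S" by blast
    have "l \<noteq> l'" using l l' by auto
    define \<phi>' where "\<phi>' = \<phi>(l := (\<phi> l)(S := \<phi> l' S), l' := (\<phi> l')(S := \<phi> l S))"
    define \<sigma> where "\<sigma> T = (if T = S then Transposition.transpose l l' else id)" for T
    have \<phi>'_eq: "\<phi>' = (\<lambda>m T. \<phi> (\<sigma> T m) T)"
      by (auto simp: \<phi>'_def \<sigma>_def fun_eq_iff Transposition.transpose_def \<open>l \<noteq> l'\<close>)
    have move: "quadratic_move (toric_configuration (nestohedron B)) (table_monomial B k \<phi>) (table_monomial B k \<phi>')"
      unfolding \<phi>'_def using less.prems(1) l l' \<open>l \<noteq> l'\<close> by (intro quadratic_move_swap)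
    \<comment> \<open>Cell \<open>(l, S)\<close> becomes correct; cell \<open>(l', S)\<close> was
      wrong already, and all others are untouched.\<close>
    have "card {(m, T). m < k \<and> T \<in> B \<and> \<phi>' m T \<noteq> \<psi> m T} < card {(m, T). m < k \<and> T \<in> B \<and> \<phi> m T \<noteq> \<psi> m T}"
    proof (rule psubset_card_mono[OF finite], rule psubsetI)
      show "{(m, T). m < k \<and> T \<in> B \<and> \<phi>' m T \<noteq> \<psi> m T} \<subseteq> {(m, T). m < k \<and> T \<in> B \<and> \<phi> m T \<noteq> \<psi> m T}"
        using l l' \<open>l \<noteq> l'\<close> by (auto simp: \<phi>'_def split: if_splits)
      have "(l, S) \<in> {(m, T). m < k \<and> T \<in> B \<and> \<phi> m T \<noteq> \<psi> m T}" using l by simp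
      moreover have "(l, S) \<notin> {(m, T). m < k \<and> T \<in> B \<and> \<phi>' m T \<noteq> \<psi> m T}"
        using l' \<open>l \<noteq> l'\<close> by (simp add: \<phi>'_def)
      ultimately show "{(m, T). m < k \<and> T \<in> B \<and> \<phi>' m T \<noteq> \<psi> m T} \<noteq> {(m, T). m < k \<and> T \<in> B \<and> \<phi> m T \<noteq> \<psi> m T}"
        by blast
    qed
    moreover have "choice_table B k \<phi>'"
      using less.prems(1) l(1,2) l'(1) by (auto simp: choice_table_def \<phi>'_def)
    moreover have "col_count k \<phi>' T j = col_count k \<psi> T j" if "T \<in> B" for T j
    proof -
      have "bij_betw (\<sigma> T) {..<k} {..<k}"
        using bij_betw_transpose_lessThan[OF l(1) l'(1)] by (simp add: \<sigma>_def bij_betw_id)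
      then show ?thesis
        unfolding \<phi>'_eq using less.prems(2)[OF that] by (simp add: col_count_permute)
    qed
    ultimately have "(quadratic_move (toric_configuration (nestohedron B)))\<^sup>*\<^sup>*
        (table_monomial B k \<phi>') (table_monomial B k \<psi>)"
      by (rule less.hyps)
    with move show ?thesis by (rule converse_rtranclp_into_rtranclp)
  qed
qed

section \<open>Tables of equal weight\<close>

text \<open>A nonempty invariant subset of least cardinality works: its image is again invariant, so
  minimality makes \<open>f\<close> surjective on it, and finiteness makes it injective. This
  supplies the cycle of columns.\<close>

lemma exists_invariant_bij:
  assumes "finite D" "D \<noteq> {}" "f ` D \<subseteq> D"
  shows "\<exists>C\<subseteq>D. C \<noteq> {} \<and> bij_betw f C C"
proof -
  let ?P = "\<lambda>C. C \<subseteq> D \<and> C \<noteq> {} \<and> f ` C \<subseteq> C"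
  obtain C where C: "?P C" and min: "\<And>C'. ?P C' \<Longrightarrow> card C \<le> card C'"
    using ex_has_least_nat[of ?P D card] assms by blast
  have "finite C" using C assms(1) finite_subset by blast
  have "card C \<le> card (f ` C)" using C by (intro min) blast
  then have "f ` C = C" using C \<open>finite C\<close> by (simp add: card_seteq)
  then have "bij_betw f C C"
    using \<open>finite C\<close> by (simp add: bij_betw_def eq_card_imp_inj_on)
  then show ?thesis using C by blast
qed

lemma sum_eq_imp_exists_gt:
  fixes a b :: "'i \<Rightarrow> nat"
  assumes "sum a X = sum b X" "finite X" "x \<in> X" "a x < b x"
  shows "\<exists>y\<in>X. b y < a y"
proof (rule ccontr)
  assume "\<not> ?thesis"
  then have "sum a X < sum b X"
    using assms by (intro sum_strict_mono_ex1) (auto simp: not_less)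
  then show False using assms by simp
qed

text \<open>Induction on the total surplus of \<open>\<phi>\<close> over \<open>\<psi>\<close>;
  truncated subtraction ignores the pairs \<open>(S, j)\<close> where \<open>\<phi>\<close> has
  fewer occurrences. Without surplus the column counts agree; otherwise a shift along a cycle of
  columns lowers it.\<close>

lemma connected_if_sum_choice_point_eq:
  fixes B :: "'n::finite set set"
  assumes "choice_table B k \<phi>" and \<psi>: "choice_table B k \<psi>"
    and "(\<Sum>l<k. choice_point B (\<phi> l)) = (\<Sum>l<k. choice_point B (\<psi> l))"
  shows "(quadratic_move (toric_configuration (nestohedron B)))\<^sup>*\<^sup>*
    (table_monomial B k \<phi>) (table_monomial B k \<psi>)"
  using assms(1,3)
proof (induction "\<Sum>(S, j)\<in>B \<times> UNIV. col_count k \<phi> S j - col_count k \<psi> S j" arbitrary: \<phi> rule: less_induct)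
  case less
  note \<phi> = less.prems(1)
  have margin: "(\<Sum>S\<in>B. col_count k \<phi> S j) = (\<Sum>S\<in>B. col_count k \<psi> S j)" for j
    using arg_cong[OF less.prems(2), of "\<lambda>v. v $ j"] unfolding sum_choice_point_nth of_nat_eq_iff .
  \<comment> \<open>The counts in a column sum to \<open>k\<close> for both tables, so a shortage in
    a column comes with a surplus in the same column.\<close>
  have rows: "\<exists>j'. col_count k \<psi> S j' < col_count k \<phi> S j'" if "col_count k \<phi> S j < col_count k \<psi> S j" for S j
    using sum_eq_imp_exists_gt[of "col_count k \<phi> S" UNIV "col_count k \<psi> S" j] that by (simp add: sum_col_count)
  define D where "D = {S\<in>B. \<exists>j. col_count k \<psi> S j < col_count k \<phi> S j}"
  show ?case
  proof (cases "D = {}")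
    case True
    then have le: "col_count k \<phi> S j \<le> col_count k \<psi> S j" if "S \<in> B" for S j
      using that by (auto simp: D_def not_less)
    have "col_count k \<phi> S j = col_count k \<psi> S j" if S: "S \<in> B" for S j
    proof (rule ccontr)
      assume "col_count k \<phi> S j \<noteq> col_count k \<psi> S j"
      then obtain j' where "col_count k \<psi> S j' < col_count k \<phi> S j'"
        using rows[of S j] le[OF S, of j] by auto
      then show False using le[OF S, of j'] by simp
    qed
    then show ?thesis by (intro connected_if_col_count_eq \<phi> \<psi>)
  next
    case False
    have "\<forall>S\<in>D. \<exists>j. col_count k \<psi> S j < col_count k \<phi> S j" by (simp add: D_def)
    then obtain x where x: "\<And>S. S \<in> D \<Longrightarrow> col_count k \<psi> S (x S) < col_count k \<phi> S (x S)"
      by metis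
    \<comment> \<open>By \<open>margin\<close>, the surplus of \<open>x S\<close> in column
      \<open>S\<close> is balanced by a shortage of the same entry in another column
      \<open>T\<close>; by \<open>rows\<close> that column has a surplus too.\<close>
    have "\<forall>S\<in>D. \<exists>T\<in>D. col_count k \<phi> T (x S) < col_count k \<psi> T (x S)"
    proof
      fix S assume "S \<in> D"
      then have "\<exists>T\<in>B. col_count k \<phi> T (x S) < col_count k \<psi> T (x S)"
        using sum_eq_imp_exists_gt[of "\<lambda>T. col_count k \<psi> T (x S)" B "\<lambda>T. col_count k \<phi> T (x S)" S]
          margin x[OF \<open>S \<in> D\<close>] by (simp add: D_def)
      then show "\<exists>T\<in>D. col_count k \<phi> T (x S) < col_count k \<psi> T (x S)"
        unfolding D_def using rows by blast
    qed
    then obtain nx where nx: "\<And>S. S \<in> D \<Longrightarrow> nx S \<in> D"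
        "\<And>S. S \<in> D \<Longrightarrow> col_count k \<phi> (nx S) (x S) < col_count k \<psi> (nx S) (x S)"
      by metis
    \<comment> \<open>The map \<open>nx\<close> leads from a column to one that lacks its surplus
      entry; it permutes the columns in \<open>C\<close>.\<close>
    obtain C where C: "C \<subseteq> D" "C \<noteq> {}" and bij: "bij_betw nx C C"
      using exists_invariant_bij[of D nx] nx(1) False by auto
    have "C \<subseteq> B" using C by (auto simp: D_def)
    \<comment> \<open>Column \<open>S\<close> in \<open>C\<close> has too many entries
      \<open>x S\<close> and too few entries \<open>x (pre S)\<close>.\<close>
    define pre where "pre = inv_into C nx"
    have pre: "pre S \<in> C" "nx (pre S) = S" if "S \<in> C" for S
      using bij that unfolding pre_def
      by (auto simp: bij_betw_def inv_into_into f_inv_into_f)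
    have gain: "col_count k \<phi> S (x (pre S)) < col_count k \<psi> S (x (pre S))" if "S \<in> C" for S
      using nx(2)[of "pre S"] pre[OF that] C by auto
    have lose: "col_count k \<psi> S (x S) < col_count k \<phi> S (x S)" if "S \<in> C" for S
      using x that C by auto
    have "\<exists>l<k. \<phi> l S = x S" if "S \<in> C" for S
      using lose[OF that] by (intro col_count_posD) simp
    then obtain t where t: "\<And>S. S \<in> C \<Longrightarrow> t S < k" "\<And>S. S \<in> C \<Longrightarrow> \<phi> (t S) S = x S" by metis
    have "0 < k" using t(1) C by fastforce
    \<comment> \<open>\<open>\<tau>\<close> collects the surplus entries \<open>x S\<close> in row 0; \<open>\<omega>\<close> then passes each one on to the next
      column of the cycle, where it is missing.\<close>
    define \<sigma> where "\<sigma> S = (if S \<in> C then Transposition.transpose 0 (t S) else id)" for S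
    define \<tau> where "\<tau> = (\<lambda>l S. \<phi> (\<sigma> S l) S)"
    define \<omega> where "\<omega> = \<tau>(0 := \<lambda>S. if S \<in> C then x (pre S) else \<tau> 0 S)"
    have \<sigma>: "bij_betw (\<sigma> S) {..<k} {..<k}" for S
      using bij_betw_transpose_lessThan[OF \<open>0 < k\<close> t(1)] by (simp add: \<sigma>_def bij_betw_id)
    have col_\<tau>: "col_count k \<tau> S j = col_count k \<phi> S j" for S j
      unfolding \<tau>_def using \<sigma> by (rule col_count_permute)
    have \<tau>0: "\<tau> 0 S = x S" if "S \<in> C" for S
      using that t by (simp add: \<tau>_def \<sigma>_def)
    have tab_\<tau>: "choice_table B k \<tau>"
      unfolding choice_table_def
    proof (intro allI impI ballI)
      fix l S assume "l < k" "S \<in> B"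
      have "\<sigma> S l < k" using bij_betwE[OF \<sigma>[of S]] \<open>l < k\<close> by blast
      then show "\<tau> l S \<in> S"
        unfolding \<tau>_def using \<phi> \<open>S \<in> B\<close> by (auto simp: choice_table_def)
    qed
    have tab_\<omega>: "choice_table B k \<omega>"
      unfolding choice_table_def
    proof (intro allI impI ballI)
      fix l S assume "l < k" "S \<in> B"
      show "\<omega> l S \<in> S"
      proof (cases "l = 0 \<and> S \<in> C")
        \<comment> \<open>The table \<open>\<psi>\<close> has the missing entry in column
          \<open>S\<close>, so that entry is an element of \<open>S\<close>.\<close>
        case True
        then obtain m where m: "m < k" "\<psi> m S = x (pre S)"
          using col_count_posD[of k \<psi> S "x (pre S)"] gain[of S] by auto
        have "\<psi> m S \<in> S" using \<psi> \<open>m < k\<close> \<open>S \<in> B\<close> by (simp add: choice_table_def)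
        then show ?thesis using True m by (simp add: \<omega>_def)
      next
        case False
        then show ?thesis using tab_\<tau> \<open>l < k\<close> \<open>S \<in> B\<close> by (auto simp: \<omega>_def choice_table_def)
      qed
    qed
    \<comment> \<open>Reindexing along \<open>nx\<close>: on \<open>C\<close>, row 0 of
      \<open>\<omega>\<close> has the same entries with multiplicity as row 0 of
      \<open>\<tau>\<close>, so the two rows represent the same point.\<close>
    have "(\<Sum>S\<in>C. axis (\<omega> 0 S) (1::int)) = (\<Sum>S\<in>C. axis (x (pre S)) 1)"
      by (simp add: \<omega>_def)
    also have "\<dots> = (\<Sum>S\<in>C. axis (x (pre (nx S))) 1)"
      by (rule sum.reindex_bij_betw[OF bij, symmetric])
    also have "\<dots> = (\<Sum>S\<in>C. axis (\<tau> 0 S) 1)"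
      using bij by (intro sum.cong) (auto simp: pre_def bij_betw_def inv_into_f_f \<tau>0)
    finally have "choice_point B (\<omega> 0) = choice_point B (\<tau> 0)"
      unfolding choice_point_def using sum.subset_diff[OF \<open>C \<subseteq> B\<close>, of "\<lambda>S. axis (\<omega> 0 S) (1::int)"]
        sum.subset_diff[OF \<open>C \<subseteq> B\<close>, of "\<lambda>S. axis (\<tau> 0 S) (1::int)"]
      by (simp add: \<omega>_def)
    then have points: "choice_point B (\<omega> l) = choice_point B (\<tau> l)" for l
      by (cases "l = 0") (simp_all add: \<omega>_def)
    have sum_\<omega>: "(\<Sum>l<k. choice_point B (\<omega> l)) = (\<Sum>l<k. choice_point B (\<psi> l))"
      unfolding less.prems(2)[symmetric] vec_eq_iff points sum_choice_point_nth col_\<tau> by simp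
    have outside: "col_count k \<omega> S j = col_count k \<phi> S j" if "S \<notin> C" for S j
    proof -
      have "\<omega> l S = \<tau> l S" for l using that by (simp add: \<omega>_def)
      then show ?thesis unfolding col_\<tau>[symmetric] by (simp add: col_count_def)
    qed
    \<comment> \<open>At most row 0 is added to the occurrences, and there was a shortage of at
      least one.\<close>
    have gained: "col_count k \<omega> S (x (pre S)) \<le> col_count k \<psi> S (x (pre S))" if "S \<in> C" for S
    proof -
      have "col_count k \<omega> S (x (pre S)) \<le> card (insert 0 {l. l < k \<and> \<tau> l S = x (pre S)})"
        unfolding col_count_def by (rule card_mono) (auto simp: \<omega>_def)
      also have "\<dots> \<le> Suc (col_count k \<tau> S (x (pre S)))"
        by (simp add: card_insert_if col_count_def)
      also have "\<dots> \<le> col_count k \<psi> S (x (pre S))"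
        using gain[OF that] by (simp add: col_\<tau>)
      finally show ?thesis .
    qed
    have other: "col_count k \<omega> S j \<le> col_count k \<phi> S j" if "S \<in> C" "j \<noteq> x (pre S)" for S j
      unfolding col_\<tau>[symmetric] unfolding col_count_def using that
      by (intro card_mono) (auto simp: \<omega>_def split: if_splits)
    have lost: "col_count k \<omega> S (x S) < col_count k \<phi> S (x S)" if "S \<in> C" for S
    proof -
      \<comment> \<open>One entry is in surplus in column \<open>S\<close> and the other in
        shortage, so they differ, and row 0 loses its \<open>x S\<close>.\<close>
      have "x S \<noteq> x (pre S)" using gain[OF that] lose[OF that] by auto
      then have "0 \<notin> {l. l < k \<and> \<omega> l S = x S}" using that by (auto simp: \<omega>_def)
      moreover have "0 \<in> {l. l < k \<and> \<tau> l S = x S}" using that \<tau>0 \<open>0 < k\<close> by simp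
      moreover have "{l. l < k \<and> \<omega> l S = x S} \<subseteq> {l. l < k \<and> \<tau> l S = x S}"
        using that \<open>x S \<noteq> x (pre S)\<close> by (auto simp: \<omega>_def split: if_splits)
      ultimately show ?thesis
        unfolding col_\<tau>[symmetric] unfolding col_count_def by (intro psubset_card_mono) auto
    qed
    have "(\<Sum>(S, j)\<in>B \<times> UNIV. col_count k \<omega> S j - col_count k \<psi> S j)
        < (\<Sum>(S, j)\<in>B \<times> UNIV. col_count k \<phi> S j - col_count k \<psi> S j)"
    proof (rule sum_strict_mono_ex1)
      \<comment> \<open>In a column of \<open>C\<close>, the truncated difference for
        \<open>\<omega>\<close> is 0 at \<open>x (pre S)\<close>, and no other count increases; the
        remaining columns keep their counts.\<close>
      have "col_count k \<omega> S j - col_count k \<psi> S j \<le> col_count k \<phi> S j - col_count k \<psi> S j" for S j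
        using outside[of S j] gained[of S] other[of S j]
        by (cases "S \<in> C"; cases "j = x (pre S)") (auto intro: diff_le_mono)
      then show "\<forall>p\<in>B \<times> UNIV. (case p of (S, j) \<Rightarrow> col_count k \<omega> S j - col_count k \<psi> S j)
          \<le> (case p of (S, j) \<Rightarrow> col_count k \<phi> S j - col_count k \<psi> S j)" by auto
      obtain S where "S \<in> C" using C by blast
      then show "\<exists>p\<in>B \<times> UNIV. (case p of (S, j) \<Rightarrow> col_count k \<omega> S j - col_count k \<psi> S j)
          < (case p of (S, j) \<Rightarrow> col_count k \<phi> S j - col_count k \<psi> S j)"
        using lost[of S] lose[of S] \<open>C \<subseteq> B\<close> by (intro bexI[of _ "(S, x S)"]) auto
    qed simp
    \<comment> \<open>The path is complete: \<open>\<phi>\<close> reaches \<open>\<tau>\<close> by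
      swaps inside columns, \<open>\<tau>\<close> and \<open>\<omega>\<close> give the same
      monomial, and \<open>\<omega>\<close> reaches \<open>\<psi>\<close> by induction.\<close>
    from less.hyps[OF this tab_\<omega> sum_\<omega>]
    have "(quadratic_move (toric_configuration (nestohedron B)))\<^sup>*\<^sup>* (table_monomial B k \<omega>) (table_monomial B k \<psi>)" .
    moreover have "table_monomial B k \<omega> = table_monomial B k \<tau>"
      by (simp add: table_monomial_def points)
    moreover have "(quadratic_move (toric_configuration (nestohedron B)))\<^sup>*\<^sup>* (table_monomial B k \<phi>) (table_monomial B k \<tau>)"
      using col_\<tau> by (intro connected_if_col_count_eq \<phi> tab_\<tau>) simp
    ultimately show ?thesis by simp
  qed
qed

section \<open>Monomials as tables, and generation of the toric ideal\<close>

text \<open>Every variable comes from some choice, so multiplying by a variable appends a row to the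
  table.\<close>

lemma monomial_eq_table_monomial:
  fixes B :: "'n::finite set set"
  assumes "Poly_Mapping.keys u \<subseteq> toric_configuration (nestohedron B)"
  shows "\<exists>k \<phi>. choice_table B k \<phi> \<and> u = table_monomial B k \<phi>"
proof -
  let ?rep = "\<lambda>u. \<exists>k \<phi>. choice_table B k \<phi> \<and> u = table_monomial B k \<phi>"
  have step: "?rep (v + Poly_Mapping.single a n)"
    if v: "?rep v" and a: "a \<in> toric_configuration (nestohedron B)" for v a n
  proof (induction n)
    case 0
    then show ?case using v by simp
  next
    case (Suc n)
    obtain f where f: "a = (choice_point B f, 1)" "\<forall>S\<in>B. f S \<in> S"
      using a by (auto simp: toric_configuration_nestohedron)
    from Suc obtain k \<phi> where k: "choice_table B k \<phi>"
      "v + Poly_Mapping.single a n = table_monomial B k \<phi>" by blast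
    have "v + Poly_Mapping.single a (Suc n) = v + Poly_Mapping.single a n + Poly_Mapping.single a 1"
      by (simp add: add.assoc flip: single_add)
    also have "\<dots> = table_monomial B (Suc k) (\<phi>(k := f))"
      unfolding k(2) by (simp add: table_monomial_def f)
    finally have "v + Poly_Mapping.single a (Suc n) = table_monomial B (Suc k) (\<phi>(k := f))" .
    moreover have "choice_table B (Suc k) (\<phi>(k := f))"
      using k f by (auto simp: choice_table_def less_Suc_eq)
    ultimately show ?case by blast
  qed
  have "?rep (\<Sum>a\<in>X. Poly_Mapping.single a (Poly_Mapping.lookup u a))"
    if "finite X" "X \<subseteq> toric_configuration (nestohedron B)" for X
    using that
  proof induction
    case empty
    show ?case by (rule exI[of _ 0]) (simp add: choice_table_def table_monomial_def)
  next
    case (insert a X)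
    then show ?case
      using step[of "\<Sum>a\<in>X. Poly_Mapping.single a (Poly_Mapping.lookup u a)" a "Poly_Mapping.lookup u a"]
      by (simp add: add.commute)
  qed
  from this[OF finite_keys assms] show ?thesis by (simp only: sum_single_lookup)
qed

text \<open>The last coordinate counts the rows, so tables of equal weight have equally
  many.\<close>

lemma toric_weight_table_monomial:
  "toric_weight (table_monomial B k \<phi>) = (\<Sum>l<k. choice_point B (\<phi> l), int k)"
  unfolding table_monomial_def toric_weight_sum toric_weight_single
  by (simp add: prod_eq_iff fst_sum snd_sum)

text \<open>The generators are all quadratic binomials of the kernel; monomials of equal weight are
  connected through their tables.\<close>

lemma toric_ideal_quadratically_generated_nestohedron:
  fixes B :: "'n::finite set set"
  shows "toric_ideal_quadratically_generated TYPE('k::field) (nestohedron B)"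
proof -
  let ?A = "toric_configuration (nestohedron B)"
  have "(quadratic_move ?A)\<^sup>*\<^sup>* u v"
    if "Poly_Mapping.keys u \<subseteq> ?A" "Poly_Mapping.keys v \<subseteq> ?A" "toric_weight u = toric_weight v" for u v
  proof -
    obtain k \<phi> where u: "choice_table B k \<phi>" "u = table_monomial B k \<phi>"
      using monomial_eq_table_monomial \<open>Poly_Mapping.keys u \<subseteq> ?A\<close> by blast
    obtain k' \<psi> where v: "choice_table B k' \<psi>" "v = table_monomial B k' \<psi>"
      using monomial_eq_table_monomial \<open>Poly_Mapping.keys v \<subseteq> ?A\<close> by blast
    have "k = k'" "(\<Sum>l<k. choice_point B (\<phi> l)) = (\<Sum>l<k. choice_point B (\<psi> l))"
      using that(3) by (auto simp: u v toric_weight_table_monomial)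
    then show ?thesis
      using connected_if_sum_choice_point_eq[of B k \<phi> \<psi>] u v by simp
  qed
  then have "toric_ideal (nestohedron B) =
      ideal_generated_in (polynomials_in ?A) (toric_quadrics ?A :: ('n exponent, 'k) polynomial set)"
    unfolding toric_ideal_def by (rule toric_kernel_eq_ideal)
  then show ?thesis
    unfolding toric_ideal_quadratically_generated_def
    by (intro exI[of _ "toric_quadrics ?A"]) (auto simp: toric_quadrics_def)
qed

theorem corollary1p4:
  fixes B :: "'n::finite set set"
  assumes "building_set B"
  shows "integer_decomposition_property (nestohedron B) \<and>
         toric_ideal_quadratically_generated TYPE('k::field) (nestohedron B)"
  using integer_decomposition_property_nestohedron toric_ideal_quadratically_generated_nestohedron
  by blast

end
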